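(* For $\alpha\in(-2,2)$, the following conditions are equivalent. (a) The function $f_\alpha$ has a unique maximizer in $[0,1/2]$. (b) $\tau^\flat(\alpha)=\tau^\sharp(\alpha)$. (c) There exists no $n\in\mathbb N$ such that $\sum_{m=0}^n\alpha^m\rho_m^\sharp(\alpha)=0$. (d) The functions $\tau^\flat$ and $\tau^\sharp$ (as functions from $(-2,2)$ to $[0,1]$) are continuous at $\alpha$.
   Context: For $\alpha\in(-2,2)$, the Takagi--Landsberg function is $f_\alpha(t)=\sum_{m=0}^\infty\frac{\alpha^m}{2^m}\phi(2^mt)$, $t\in[0,1]$, where $\phi(t)=\min_{z\in\mathbb Z}|t-z|$. A maximizer of $f_\alpha$ is a point of $[0,1]$ at which the global maximum of $f_\alpha$ over $[0,1]$ is attained. Sequences $\boldsymbol\rho^\flat(\alpha),\boldsymbol\rho^\sharp(\alpha)\in\{-1,+1\}^{\mathbb N_0}$ are defined recursively by $\rho_0^\flat(\alpha)=\rho_0^\sharp(\alpha)=1$ and, for $n\in\mathbb N=\{1,2,\dots\}$: $\rho_n^\flat(\alpha)=+1$ if $\sum_{m=0}^{n-1}\alpha^m\rho_m^\flat(\alpha)<0$ and $\rho_n^\flat(\alpha)=-1$ otherwise; $\rho_n^\sharp(\alpha)=+1$ if $\sum_{m=0}^{n-1}\alpha^m\rho_m^\sharp(\alpha)\le0$ and $\rho_n^\sharp(\alpha)=-1$ otherwise. For a $\{-1,+1\}$-valued sequence $\boldsymbol\rho=(\rho_n)_{n\ge0}$, $T(\boldsymbol\rho):=\sum_{n=0}^\infty2^{-(n+2)}(1-\rho_n)$.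 Finally $\tau^\flat(\alpha):=T(\boldsymbol\rho^\flat(\alpha))$ and $\tau^\sharp(\alpha):=T(\boldsymbol\rho^\sharp(\alpha))$. *)

theory Defs
  imports "HOL-Analysis.Analysis"
begin

text \<open>Distance to the nearest integer; the infimum over the integers is attained.\<close>

definition tent :: "real \<Rightarrow> real" where
  "tent t = (INF z::int. \<bar>t - of_int z\<bar>)"

definition takagi_landsberg :: "real \<Rightarrow> real \<Rightarrow> real" where
  "takagi_landsberg \<alpha> t = (\<Sum>m. \<alpha> ^ m / 2 ^ m * tent (2 ^ m * t))"

definition is_maximizer :: "real \<Rightarrow> real \<Rightarrow> bool" where
  "is_maximizer \<alpha> t \<longleftrightarrow>
     t \<in> {0..1} \<and> (\<forall>s\<in>{0..1}. takagi_landsberg \<alpha> s \<le> takagi_landsberg \<alpha> t)"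

fun rho_flat :: "real \<Rightarrow> nat \<Rightarrow> real" where
  "rho_flat \<alpha> 0 = 1"
| "rho_flat \<alpha> (Suc n) = (if (\<Sum>m\<le>n. \<alpha> ^ m * rho_flat \<alpha> m) < 0 then 1 else -1)"

fun rho_sharp :: "real \<Rightarrow> nat \<Rightarrow> real" where
  "rho_sharp \<alpha> 0 = 1"
| "rho_sharp \<alpha> (Suc n) = (if (\<Sum>m\<le>n. \<alpha> ^ m * rho_sharp \<alpha> m) \<le> 0 then 1 else -1)"

definition sign_point :: "(nat \<Rightarrow> real) \<Rightarrow> real" where
  "sign_point \<rho> = (\<Sum>n. (1 - \<rho> n) / 2 ^ (n + 2))"

definition tau_flat :: "real \<Rightarrow> real" where
  "tau_flat \<alpha> = sign_point (rho_flat \<alpha>)"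

definition tau_sharp :: "real \<Rightarrow> real" where
  "tau_sharp \<alpha> = sign_point (rho_sharp \<alpha>)"

end

theory Submission
  imports Defs
begin

text \<open>Reading a sign sequence as binary digits yields nested dyadic intervals. Reflecting a point
  of the \<open>n\<close>-th interval about its midpoint changes the Takagi--Landsberg function by the
  displacement times the slope \<open>\<Sum>m<n. \<alpha>^m \<rho>\<^sub>m\<close>. If each sign is opposite to its slope
  (or the slope vanishes), such reflections push any point of \<open>[0,1]\<close> into the nested intervals
  without lowering the function; so the limit point is a maximizer, and the only one in
  \<open>[0,1/2]\<close> if no slope of positive index vanishes, as the reflections then strictly increase.
  If the slope first vanishes at \<open>N\<close>, the sharp and flat sequences are negatives of each other
  from \<open>N\<close> on, and since \<open>1 - \<alpha> - \<alpha>^2 - \<dots>\<close> cannot keep positive partial sums there, the two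
  points lie strictly on either side of a midpoint. On a side of \<open>\<alpha>\<close> where the slope polynomial
  is nonzero its sign forces both points to the same side of that midpoint, so one of them jumps.\<close>

section \<open>Sign sequences and nested dyadic intervals\<close>

definition sign_seq :: "(nat \<Rightarrow> real) \<Rightarrow> bool" where
  "sign_seq \<rho> \<longleftrightarrow> (\<forall>n. \<rho> n = 1 \<or> \<rho> n = -1)"

text \<open>Truncation of the series in \<open>sign_point\<close>: the binary digit
  \<open>(1 - \<rho> k) / 2\<close> stands at place k + 1, so sign +1 selects the left half and sign
  -1 the right half of the current interval.\<close>

definition left_end :: "(nat \<Rightarrow> real) \<Rightarrow> nat \<Rightarrow> real" where
  "left_end \<rho> n = (\<Sum>k<n. (1 - \<rho> k) / 2 ^ (k + 2))"

definition dyadic_interval :: "(nat \<Rightarrow> real) \<Rightarrow> nat \<Rightarrow> real set" where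
  "dyadic_interval \<rho> n = {left_end \<rho> n .. left_end \<rho> n + 1 / 2 ^ n}"

text \<open>On \<open>dyadic_interval \<rho> n\<close> the first \<open>n\<close> summands of the Takagi--Landsberg
  function are affine, with total slope \<open>slope \<alpha> \<rho> n\<close>.\<close>

definition slope :: "real \<Rightarrow> (nat \<Rightarrow> real) \<Rightarrow> nat \<Rightarrow> real" where
  "slope \<alpha> \<rho> n = (\<Sum>m<n. \<alpha> ^ m * \<rho> m)"

definition step_seq :: "real \<Rightarrow> (nat \<Rightarrow> real) \<Rightarrow> bool" where
  "step_seq \<alpha> \<rho> \<longleftrightarrow> sign_seq \<rho> \<and> (\<forall>n. \<rho> n * slope \<alpha> \<rho> n \<le> 0)"

lemma sign_seqD: "sign_seq \<rho> \<Longrightarrow> \<rho> n = 1 \<or> \<rho> n = -1"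
  by (simp add: sign_seq_def)

lemma left_end_0 [simp]: "left_end \<rho> 0 = 0"
  and left_end_Suc: "left_end \<rho> (Suc n) = left_end \<rho> n + (1 - \<rho> n) / 2 ^ (n + 2)"
  by (simp_all add: left_end_def)

lemma slope_0 [simp]: "slope \<alpha> \<rho> 0 = 0"
  and slope_Suc: "slope \<alpha> \<rho> (Suc n) = slope \<alpha> \<rho> n + \<alpha> ^ n * \<rho> n"
  by (simp_all add: slope_def)

lemma left_end_cong: "(\<And>k. k < n \<Longrightarrow> \<rho> k = \<rho>' k) \<Longrightarrow> left_end \<rho> n = left_end \<rho>' n"
  by (simp add: left_end_def)

lemma slope_cong: "(\<And>k. k < n \<Longrightarrow> \<rho> k = \<rho>' k) \<Longrightarrow> slope \<alpha> \<rho> n = slope \<alpha> \<rho>' n"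
  by (simp add: slope_def)

text \<open>Being multiples of 1/2^n, the endpoints of level n become integers after scaling.
  \<open>tent\<close> is then explicit on the scaled intervals, and reflections act there as t -> k
  - t with k an integer.\<close>

lemma left_end_scaled_int:
  assumes "sign_seq \<rho>"
  shows "2 ^ n * left_end \<rho> n \<in> \<int>"
proof (induction n)
  case (Suc n)
  have "2 ^ Suc n * left_end \<rho> (Suc n) = 2 * (2 ^ n * left_end \<rho> n) + (1 - \<rho> n) / 2"
    by (simp add: left_end_Suc field_simps)
  moreover have "(1 - \<rho> n) / 2 \<in> \<int>"
    using sign_seqD[OF assms, of n] by auto
  ultimately show ?case
    using Suc by auto
qed simp

lemma left_end_mono:
  assumes "sign_seq \<rho>" "m \<le> n"
  shows "left_end \<rho> m \<le> left_end \<rho> n"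
  using assms(2)
proof (induction n rule: dec_induct)
  case (step n)
  have "left_end \<rho> n \<le> left_end \<rho> (Suc n)"
    using sign_seqD[OF assms(1), of n] by (auto simp: left_end_Suc)
  with step show ?case by linarith
qed simp

lemma right_end_antimono:
  assumes "sign_seq \<rho>" "m \<le> n"
  shows "left_end \<rho> n + 1 / 2 ^ n \<le> left_end \<rho> m + 1 / 2 ^ m"
  using assms(2)
proof (induction n rule: dec_induct)
  case (step n)
  have "left_end \<rho> (Suc n) + 1 / 2 ^ Suc n \<le> left_end \<rho> n + 1 / 2 ^ n"
    using sign_seqD[OF assms(1), of n] by (auto simp: left_end_Suc field_simps)
  with step show ?case by linarith
qed simp

lemma left_end_tendsto:
  assumes "sign_seq \<rho>"
  shows "left_end \<rho> \<longlonglongrightarrow> sign_point \<rho>"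
proof -
  have "summable (\<lambda>n. (1 - \<rho> n) / 2 ^ (n + 2))"
  proof (rule summable_comparison_test)
    show "summable (\<lambda>n. (1 / 2 :: real) ^ n)"
      by (simp add: summable_geometric)
    have "norm ((1 - \<rho> n) / 2 ^ (n + 2)) \<le> (1 / 2) ^ n" for n
      using sign_seqD[OF assms, of n] by (auto simp: field_simps)
    then show "\<exists>N. \<forall>n\<ge>N. norm ((1 - \<rho> n) / 2 ^ (n + 2)) \<le> (1 / 2) ^ n"
      by blast
  qed
  from summable_LIMSEQ[OF this] show ?thesis
    by (simp add: left_end_def[abs_def] sign_point_def)
qed

lemma sign_point_mem:
  assumes "sign_seq \<rho>"
  shows "sign_point \<rho> \<in> dyadic_interval \<rho> n"
proof -
  have "left_end \<rho> n \<le> sign_point \<rho>"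
    by (rule LIMSEQ_le_const[OF left_end_tendsto[OF assms]])
       (use left_end_mono[OF assms] in blast)
  moreover have "sign_point \<rho> \<le> left_end \<rho> n + 1 / 2 ^ n"
  proof (rule LIMSEQ_le_const2[OF left_end_tendsto[OF assms]], intro exI allI impI)
    fix k assume "n \<le> k"
    have "(0::real) \<le> 1 / 2 ^ k" by simp
    with right_end_antimono[OF assms \<open>n \<le> k\<close>] show "left_end \<rho> k \<le> left_end \<rho> n + 1 / 2 ^ n"
      by linarith
  qed
  ultimately show ?thesis by (simp add: dyadic_interval_def)
qed

lemma tendsto_sign_point:
  assumes "sign_seq \<rho>" "\<And>n. x n \<in> dyadic_interval \<rho> n"
  shows "x \<longlonglongrightarrow> sign_point \<rho>"
proof (rule tendsto_sandwich)
  show "left_end \<rho> \<longlonglongrightarrow> sign_point \<rho>"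
    by (rule left_end_tendsto[OF assms(1)])
  have "(\<lambda>n. left_end \<rho> n + (1 / 2) ^ n) \<longlonglongrightarrow> sign_point \<rho> + 0"
    by (intro tendsto_add left_end_tendsto[OF assms(1)] LIMSEQ_power_zero) simp
  then show "(\<lambda>n. left_end \<rho> n + 1 / 2 ^ n) \<longlonglongrightarrow> sign_point \<rho>"
    by (simp add: power_divide)
  show "\<forall>\<^sub>F n in sequentially. left_end \<rho> n \<le> x n"
       "\<forall>\<^sub>F n in sequentially. x n \<le> left_end \<rho> n + 1 / 2 ^ n"
    using assms(2) by (auto simp: dyadic_interval_def)
qed

text \<open>A single sign +1 suffices for strictness: only an all-minus tail ends at the right
  endpoint. The next lemma is the mirror case.\<close>

lemma sign_point_less_right_end:
  assumes "sign_seq \<rho>" "n \<le> k" "\<rho> k = 1"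
  shows "sign_point \<rho> < left_end \<rho> n + 1 / 2 ^ n"
proof -
  have "sign_point \<rho> \<le> left_end \<rho> k + 1 / 2 ^ Suc k"
    using sign_point_mem[OF assms(1), of "Suc k"] assms(3)
    by (simp add: dyadic_interval_def left_end_Suc)
  also have "\<dots> < left_end \<rho> k + 1 / 2 ^ k"
    by (simp add: field_simps)
  also have "\<dots> \<le> left_end \<rho> n + 1 / 2 ^ n"
    by (rule right_end_antimono[OF assms(1,2)])
  finally show ?thesis .
qed

lemma left_end_less_sign_point:
  assumes "sign_seq \<rho>" "n \<le> k" "\<rho> k = -1"
  shows "left_end \<rho> n < sign_point \<rho>"
proof -
  have "left_end \<rho> n \<le> left_end \<rho> k"
    by (rule left_end_mono[OF assms(1,2)])
  also have "\<dots> < left_end \<rho> (Suc k)"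
    using assms(3) by (simp add: left_end_Suc)
  also have "\<dots> \<le> sign_point \<rho>"
    using sign_point_mem[OF assms(1), of "Suc k"] by (simp add: dyadic_interval_def)
  finally show ?thesis .
qed

section \<open>Distance to the nearest integer\<close>

lemma tent_le: "tent t \<le> \<bar>t - of_int z\<bar>"
  unfolding tent_def by (rule cINF_lower) (auto intro!: bdd_belowI[of _ 0])

lemma tent_greatest: "(\<And>z::int. c \<le> \<bar>t - of_int z\<bar>) \<Longrightarrow> c \<le> tent t"
  unfolding tent_def by (rule cINF_greatest) auto

lemma tent_nonneg: "0 \<le> tent t"
  by (rule tent_greatest) simp

lemma tent_le_1: "tent t \<le> 1"
  using tent_le[of t "\<lfloor>t\<rfloor>"] by linarith

lemma tent_lipschitz: "tent s \<le> tent t + \<bar>s - t\<bar>"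
proof -
  have "tent s - \<bar>s - t\<bar> \<le> tent t"
  proof (rule tent_greatest)
    fix z :: int
    show "tent s - \<bar>s - t\<bar> \<le> \<bar>t - of_int z\<bar>"
      using tent_le[of s z] by linarith
  qed
  then show ?thesis by linarith
qed

lemma continuous_on_tent: "continuous_on UNIV tent"
proof (rule continuous_on_iff[THEN iffD2], intro ballI allI impI)
  fix x e :: real assume "e > 0"
  have "dist (tent y) (tent x) \<le> dist y x" for y
    using tent_lipschitz[of x y] tent_lipschitz[of y x] by (simp add: dist_real_def abs_le_iff)
  then show "\<exists>d>0. \<forall>y\<in>UNIV. dist y x < d \<longrightarrow> dist (tent y) (tent x) < e"
    using \<open>e > 0\<close> by (meson le_less_trans)
qed

lemma tent_int_minus_le:
  assumes "k \<in> \<int>"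
  shows "tent (k - t) \<le> tent t"
proof (rule tent_greatest)
  fix z :: int
  obtain j where "k = of_int j" using assms by (auto elim: Ints_cases)
  \<comment> \<open>The integer \<open>j - z\<close> is as far from \<open>k - t\<close> as
    \<open>z\<close> is from \<open>t\<close>.\<close>
  then show "tent (k - t) \<le> \<bar>t - of_int z\<bar>"
    using tent_le[of "k - t" "j - z"] by simp
qed

text \<open>The map t -> k - t is an involution, so the inequality applied twice gives
  equality.\<close>

lemma tent_int_minus: "k \<in> \<int> \<Longrightarrow> tent (k - t) = tent t"
  using tent_int_minus_le[of k t] tent_int_minus_le[of k "k - t"] by simp

lemma tent_lower_half:
  assumes "k \<in> \<int>" "k \<le> t" "t \<le> k + 1 / 2"
  shows "tent t = t - k"
proof -
  obtain j where j: "k = of_int j" using assms by (auto elim: Ints_cases)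
  have "t - k \<le> tent t"
  proof (rule tent_greatest)
    fix z :: int
    have "z \<le> j \<or> z \<ge> j + 1" by arith
    then have "real_of_int z \<le> k \<or> real_of_int z \<ge> k + 1"
      unfolding j by linarith
    then show "t - k \<le> \<bar>t - of_int z\<bar>" using assms by linarith
  qed
  with tent_le[of t j] j assms show ?thesis by simp
qed

lemma tent_upper_half:
  assumes "k \<in> \<int>" "k + 1 / 2 \<le> t" "t \<le> k + 1"
  shows "tent t = k + 1 - t"
  using tent_lower_half[of 0 "k + 1 - t"] tent_int_minus[of "k + 1" t] assms by simp

section \<open>Convergence and continuity of the Takagi-Landsberg series\<close>

lemma takagi_landsberg_term_le:
  "norm (\<alpha> ^ m / 2 ^ m * tent t) \<le> (\<bar>\<alpha>\<bar> / 2) ^ m"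
proof -
  have "norm (\<alpha> ^ m / 2 ^ m * tent t) = (\<bar>\<alpha>\<bar> / 2) ^ m * tent t"
    using tent_nonneg[of t] by (simp add: abs_mult power_abs power_divide)
  also have "\<dots> \<le> (\<bar>\<alpha>\<bar> / 2) ^ m"
    using tent_le_1[of t] tent_nonneg[of t] by (intro mult_left_le) auto
  finally show ?thesis .
qed

lemma summable_takagi_landsberg:
  assumes "\<bar>\<alpha>\<bar> < 2"
  shows "summable (\<lambda>m. \<alpha> ^ m / 2 ^ m * tent (2 ^ m * t))"
proof (rule summable_comparison_test)
  show "summable (\<lambda>m. (\<bar>\<alpha>\<bar> / 2) ^ m)"
    using assms by (simp add: summable_geometric)
  show "\<exists>N. \<forall>m\<ge>N. norm (\<alpha> ^ m / 2 ^ m * tent (2 ^ m * t)) \<le> (\<bar>\<alpha>\<bar> / 2) ^ m"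
    using takagi_landsberg_term_le by blast
qed

lemma isCont_takagi_landsberg:
  assumes "\<bar>\<alpha>\<bar> < 2"
  shows "isCont (takagi_landsberg \<alpha>) t"
proof -
  have "uniform_limit UNIV (\<lambda>n t. \<Sum>m<n. \<alpha> ^ m / 2 ^ m * tent (2 ^ m * t))
          (\<lambda>t. \<Sum>m. \<alpha> ^ m / 2 ^ m * tent (2 ^ m * t)) sequentially"
  proof (rule Weierstrass_m_test)
    show "summable (\<lambda>m. (\<bar>\<alpha>\<bar> / 2) ^ m)"
      using assms by (simp add: summable_geometric)
    show "norm (\<alpha> ^ m / 2 ^ m * tent (2 ^ m * t)) \<le> (\<bar>\<alpha>\<bar> / 2) ^ m" for m t
      by (rule takagi_landsberg_term_le)
  qed
  then have "continuous_on UNIV (\<lambda>t. \<Sum>m. \<alpha> ^ m / 2 ^ m * tent (2 ^ m * t))"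
    by (rule uniform_limit_theorem[rotated])
       (auto intro!: always_eventually continuous_intros
          continuous_on_compose2[OF continuous_on_tent])
  then show ?thesis
    by (simp add: takagi_landsberg_def[abs_def] continuous_on_eq_continuous_at)
qed

section \<open>Affine part and reflection\<close>

lemma dyadic_interval_decseq:
  assumes "sign_seq \<rho>" "m \<le> n"
  shows "dyadic_interval \<rho> n \<subseteq> dyadic_interval \<rho> m"
  using left_end_mono[OF assms] right_end_antimono[OF assms] by (auto simp: dyadic_interval_def)

text \<open>Scaled by 2^m, the interval of level m + 1 is one half of a unit interval between
  consecutive integers, the half being chosen by \<open>\<rho> m\<close>; as a function of the
  scaled variable, \<open>tent\<close> has slope \<open>\<rho> m\<close> there.\<close>

lemma tent_on_dyadic_interval:
  assumes "sign_seq \<rho>" "x \<in> dyadic_interval \<rho> (Suc m)"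
  shows "tent (2 ^ m * x) = \<rho> m * (2 ^ m * (x - left_end \<rho> m)) + (1 - \<rho> m) / 2"
proof -
  have lb: "2 ^ m * left_end \<rho> (Suc m) \<le> 2 ^ m * x"
    and ub: "2 ^ m * x \<le> 2 ^ m * (left_end \<rho> (Suc m) + 1 / 2 ^ Suc m)"
    using assms(2) by (auto simp: dyadic_interval_def)
  have *: "2 ^ m * left_end \<rho> (Suc m) = 2 ^ m * left_end \<rho> m + (1 - \<rho> m) / 4"
    by (simp add: left_end_Suc field_simps)
  then have **: "2 ^ m * (left_end \<rho> (Suc m) + 1 / 2 ^ Suc m)
      = 2 ^ m * left_end \<rho> m + (1 - \<rho> m) / 4 + 1 / 2"
    by (simp add: distrib_left)
  note int = left_end_scaled_int[OF assms(1), of m]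
  from sign_seqD[OF assms(1), of m] show ?thesis
  proof
    assume "\<rho> m = 1"
    with tent_lower_half[OF int, of "2 ^ m * x"] lb ub show ?thesis
      unfolding * ** by (simp add: right_diff_distrib)
  next
    assume "\<rho> m = -1"
    with tent_upper_half[OF int, of "2 ^ m * x"] lb ub show ?thesis
      unfolding * ** by (simp add: right_diff_distrib)
  qed
qed

text \<open>The summands of index at least \<open>n\<close> are symmetric about the midpoint of the interval,
  so only the affine part contributes.\<close>

lemma takagi_landsberg_reflect:
  fixes \<rho> n x
  defines "y \<equiv> 2 * left_end \<rho> n + 1 / 2 ^ n - x"
  assumes "\<bar>\<alpha>\<bar> < 2" "sign_seq \<rho>" "x \<in> dyadic_interval \<rho> n"
  shows "takagi_landsberg \<alpha> y - takagi_landsberg \<alpha> x = slope \<alpha> \<rho> n * (y - x)"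
proof -
  define g where "g m t = \<alpha> ^ m / 2 ^ m * tent (2 ^ m * t)" for m t
  have y: "y \<in> dyadic_interval \<rho> n"
    using assms by (auto simp: dyadic_interval_def)
  have low: "g m y - g m x = \<alpha> ^ m * \<rho> m * (y - x)" if "m < n" for m
  proof -
    have "x \<in> dyadic_interval \<rho> (Suc m)" "y \<in> dyadic_interval \<rho> (Suc m)"
      using y assms(4) dyadic_interval_decseq[OF assms(3), of "Suc m" n] that by auto
    then have "tent (2 ^ m * y) - tent (2 ^ m * x) = \<rho> m * (2 ^ m * (y - x))"
      by (simp only: tent_on_dyadic_interval[OF assms(3)]) (simp add: algebra_simps)
    then have "\<alpha> ^ m / 2 ^ m * (tent (2 ^ m * y) - tent (2 ^ m * x)) = \<alpha> ^ m * \<rho> m * (y - x)"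
      by simp
    then show ?thesis
      by (simp only: g_def right_diff_distrib)
  qed
  have high: "g m y - g m x = 0" if "n \<le> m" for m
  proof -
    obtain d where d: "m = n + d" using le_Suc_ex[OF \<open>n \<le> m\<close>] by blast
    \<comment> \<open>Twice the midpoint, scaled by 2^m, is an integer because m \<ge> n, so the
      reflection leaves this value of \<open>tent\<close> unchanged.\<close>
    have "2 ^ m * y = (2 * 2 ^ d * (2 ^ n * left_end \<rho> n) + 2 ^ d) - 2 ^ m * x"
      by (simp add: y_def d power_add field_simps)
    also have "tent \<dots> = tent (2 ^ m * x)"
      by (intro tent_int_minus Ints_add Ints_mult Ints_power Ints_numeral
          left_end_scaled_int[OF assms(3)])
    finally show ?thesis by (simp add: g_def)
  qed
  have "takagi_landsberg \<alpha> y - takagi_landsberg \<alpha> x = (\<Sum>m. g m y - g m x)"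
    unfolding takagi_landsberg_def g_def
    by (intro suminf_diff summable_takagi_landsberg assms)
  also have "\<dots> = (\<Sum>m<n. g m y - g m x)"
    by (rule suminf_finite) (use high in auto)
  also have "\<dots> = slope \<alpha> \<rho> n * (y - x)"
    by (simp add: low slope_def sum_distrib_right)
  finally show ?thesis .
qed

section \<open>Maximizers from step sequences\<close>

lemma dyadic_interval_0 [simp]: "dyadic_interval \<rho> 0 = {0..1}"
  by (simp add: dyadic_interval_def)

text \<open>A point outside the chosen half is reflected into it. The displacement has sign opposite
  to \<open>\<rho> n\<close>, and so has the slope unless it is zero; hence their product, the gain,
  is nonnegative and vanishes only with the slope.\<close>

lemma ascend_dyadic_interval:
  assumes "\<bar>\<alpha>\<bar> < 2" "step_seq \<alpha> \<rho>" "x \<in> dyadic_interval \<rho> n" "x \<notin> dyadic_interval \<rho> (Suc n)"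
  obtains y where "y \<in> dyadic_interval \<rho> (Suc n)"
    "takagi_landsberg \<alpha> x \<le> takagi_landsberg \<alpha> y"
    "slope \<alpha> \<rho> n \<noteq> 0 \<Longrightarrow> takagi_landsberg \<alpha> x < takagi_landsberg \<alpha> y"
proof -
  define y where "y = 2 * left_end \<rho> n + 1 / 2 ^ n - x"
  define S where "S = slope \<alpha> \<rho> n"
  have s: "sign_seq \<rho>" and S: "\<rho> n * S \<le> 0"
    using assms(2) by (auto simp: step_seq_def S_def)
  have refl: "takagi_landsberg \<alpha> y - takagi_landsberg \<alpha> x = S * (y - x)"
    unfolding y_def S_def by (rule takagi_landsberg_reflect[OF assms(1) s assms(3)])
  define h :: real where "h = 1 / 2 ^ Suc n"
  have h: "1 / 2 ^ n = 2 * h" "h > 0" by (simp_all add: h_def)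
  have I: "dyadic_interval \<rho> (Suc n) = {left_end \<rho> n + (1 - \<rho> n) / 2 * h .. left_end \<rho> n + (1 - \<rho> n) / 2 * h + h}"
    by (simp add: dyadic_interval_def left_end_Suc h_def)
  have x: "left_end \<rho> n \<le> x" "x \<le> left_end \<rho> n + 2 * h"
    using assms(3) by (auto simp: dyadic_interval_def h)
  \<comment> \<open>Lying outside a closed half, \<open>x\<close> is not the midpoint, so the
    displacement is nonzero.\<close>
  have "y \<in> dyadic_interval \<rho> (Suc n) \<and> \<rho> n * (y - x) < 0"
    using sign_seqD[OF s, of n] x assms(4) h(2) unfolding I y_def h(1) by auto
  moreover have "0 \<le> S * (y - x) \<and> (S \<noteq> 0 \<longrightarrow> 0 < S * (y - x))" if "\<rho> n * (y - x) < 0"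
    using sign_seqD[OF s, of n] S that
    by (auto simp: zero_le_mult_iff zero_less_mult_iff)
  ultimately show ?thesis
    using refl by (intro that[of y]) (auto simp: S_def)
qed

lemma step_seq_maximizer:
  assumes "\<bar>\<alpha>\<bar> < 2" "step_seq \<alpha> \<rho>"
  shows "is_maximizer \<alpha> (sign_point \<rho>)"
proof -
  have s: "sign_seq \<rho>" using assms(2) by (simp add: step_seq_def)
  have "takagi_landsberg \<alpha> t \<le> takagi_landsberg \<alpha> (sign_point \<rho>)" if "t \<in> {0..1}" for t
  proof -
    \<comment> \<open>The points for different n may be chosen independently: membership in the
      nested intervals alone forces convergence, and continuity carries the bound to the
      limit.\<close>
    have "\<exists>x\<in>dyadic_interval \<rho> n. takagi_landsberg \<alpha> t \<le> takagi_landsberg \<alpha> x" for n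
    proof (induction n)
      case 0
      then show ?case using that by auto
    next
      case (Suc n)
      then obtain x where x: "x \<in> dyadic_interval \<rho> n" "takagi_landsberg \<alpha> t \<le> takagi_landsberg \<alpha> x"
        by blast
      show ?case
      proof (cases "x \<in> dyadic_interval \<rho> (Suc n)")
        case False
        then show ?thesis
          using ascend_dyadic_interval[OF assms x(1)] x(2) by (metis order_trans)
      qed (use x in blast)
    qed
    then obtain x where x: "\<And>n. x n \<in> dyadic_interval \<rho> n"
        "\<And>n. takagi_landsberg \<alpha> t \<le> takagi_landsberg \<alpha> (x n)"
      by metis
    have "(\<lambda>n. takagi_landsberg \<alpha> (x n)) \<longlonglongrightarrow> takagi_landsberg \<alpha> (sign_point \<rho>)"
      by (rule isCont_tendsto_compose[OF isCont_takagi_landsberg[OF assms(1)]])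
         (rule tendsto_sign_point[OF s x(1)])
    then show ?thesis
      by (rule LIMSEQ_le_const) (use x(2) in blast)
  qed
  then show ?thesis
    using sign_point_mem[OF s, of 0] by (simp add: is_maximizer_def)
qed

text \<open>The start is level 1 because the slope of index 0 is always zero: reflection about 1/2
  preserves the function, so uniqueness can be expected only within one half of the unit
  interval.\<close>

lemma maximizer_unique:
  assumes "\<bar>\<alpha>\<bar> < 2" "step_seq \<alpha> \<rho>" "\<And>n. n \<ge> 1 \<Longrightarrow> slope \<alpha> \<rho> n \<noteq> 0"
    and "is_maximizer \<alpha> t" "t \<in> dyadic_interval \<rho> 1"
  shows "t = sign_point \<rho>"
proof -
  have s: "sign_seq \<rho>" using assms(2) by (simp add: step_seq_def)
  have pos: "t \<in> dyadic_interval \<rho> n" if "n \<ge> 1" for n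
    using that
  proof (induction n rule: dec_induct)
    case (step n)
    show ?case
    proof (rule ccontr)
      assume "t \<notin> dyadic_interval \<rho> (Suc n)"
      then obtain y where y: "y \<in> dyadic_interval \<rho> (Suc n)"
          "takagi_landsberg \<alpha> t < takagi_landsberg \<alpha> y"
        using ascend_dyadic_interval[OF assms(1,2) step.IH] assms(3)[OF step.hyps(1)] by metis
      moreover have "y \<in> {0..1}"
        using y(1) dyadic_interval_decseq[OF s, of 0 "Suc n"] by auto
      ultimately show False
        using assms(4) by (force simp: is_maximizer_def)
    qed
  qed (use assms in simp)
  have "t \<in> dyadic_interval \<rho> n" for n
    using pos[of n] assms(4) by (cases n) (auto simp: is_maximizer_def)
  then have "(\<lambda>_. t) \<longlonglongrightarrow> sign_point \<rho>"
    by (rule tendsto_sign_point[OF s])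
  then show ?thesis
    using LIMSEQ_unique tendsto_const by blast
qed

section \<open>The flat and sharp sequences\<close>

lemma rho_flat_pos:
  "0 < n \<Longrightarrow> rho_flat \<alpha> n = (if slope \<alpha> (rho_flat \<alpha>) n < 0 then 1 else -1)"
  by (cases n) (simp_all add: slope_def lessThan_Suc_atMost)

lemma rho_sharp_pos:
  "0 < n \<Longrightarrow> rho_sharp \<alpha> n = (if slope \<alpha> (rho_sharp \<alpha>) n \<le> 0 then 1 else -1)"
  by (cases n) (simp_all add: slope_def lessThan_Suc_atMost)

declare rho_flat.simps(2) [simp del] rho_sharp.simps(2) [simp del]

lemma sign_seq_rho_flat: "sign_seq (rho_flat \<alpha>)"
  unfolding sign_seq_def by (metis rho_flat.simps(1) rho_flat_pos gr0I)

lemma sign_seq_rho_sharp: "sign_seq (rho_sharp \<alpha>)"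
  unfolding sign_seq_def by (metis rho_sharp.simps(1) rho_sharp_pos gr0I)

lemma step_seq_rho_flat: "step_seq \<alpha> (rho_flat \<alpha>)"
  unfolding step_seq_def
proof (intro conjI allI)
  show "rho_flat \<alpha> n * slope \<alpha> (rho_flat \<alpha>) n \<le> 0" for n
    using rho_flat_pos[of n \<alpha>] by (cases "n = 0") auto
qed (rule sign_seq_rho_flat)

lemma step_seq_rho_sharp: "step_seq \<alpha> (rho_sharp \<alpha>)"
  unfolding step_seq_def
proof (intro conjI allI)
  show "rho_sharp \<alpha> n * slope \<alpha> (rho_sharp \<alpha>) n \<le> 0" for n
    using rho_sharp_pos[of n \<alpha>] by (cases "n = 0") auto
qed (rule sign_seq_rho_sharp)

text \<open>The two rules disagree only at a zero slope, and at index 0 both signs are 1 by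
  definition.\<close>

lemma rho_flat_eq_rho_sharp:
  assumes "\<And>k. 1 \<le> k \<Longrightarrow> k < N \<Longrightarrow> slope \<alpha> (rho_sharp \<alpha>) k \<noteq> 0" "n < N"
  shows "rho_flat \<alpha> n = rho_sharp \<alpha> n"
  using assms(2)
proof (induction n rule: less_induct)
  case (less n)
  then have "slope \<alpha> (rho_flat \<alpha>) n = slope \<alpha> (rho_sharp \<alpha>) n"
    by (intro slope_cong) auto
  then show ?case
    using assms(1)[of n] less.prems by (cases "n = 0") (auto simp: rho_flat_pos rho_sharp_pos)
qed

section \<open>The first vanishing slope\<close>

text \<open>Keeping the factor 1 - \<alpha> avoids a division and covers \<alpha> = 1.\<close>

lemma one_minus_geometric:
  "(1 - \<alpha>) * (1 - (\<Sum>j=1..i. \<alpha> ^ j)) = 1 - 2 * \<alpha> + \<alpha> ^ Suc i" for \<alpha> :: real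
  by (induction i) (auto simp: algebra_simps)

text \<open>A plus after a zero slope, followed by minus signs, restarts the pattern 1, -1, -1, ...
  scaled by \<alpha>^N. With N = 0 this also describes an initial segment.\<close>

lemma slope_minus_tail:
  assumes "\<And>j. 1 \<le> j \<Longrightarrow> j \<le> i \<Longrightarrow> \<rho> (N + j) = -1" "slope \<alpha> \<rho> N = 0" "\<rho> N = 1"
  shows "slope \<alpha> \<rho> (Suc (N + i)) = \<alpha> ^ N * (1 - (\<Sum>j=1..i. \<alpha> ^ j))"
  using assms
proof (induction i)
  case (Suc i)
  have "slope \<alpha> \<rho> (Suc (N + Suc i)) = slope \<alpha> \<rho> (Suc (N + i)) - \<alpha> ^ (N + Suc i)"
    using Suc.prems(1)[of "Suc i"] by (simp add: slope_Suc[of _ _ "Suc (N + i)"])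
  with Suc show ?case by (simp add: algebra_simps power_add)
qed (simp add: slope_Suc)

text \<open>Positive slopes force minus signs, and for these \<alpha> the resulting 1 - \<alpha> -
  ... - \<alpha>^n stays positive, so no tie ever occurs.\<close>

lemma slope_rho_sharp_pos:
  assumes "-1 \<le> \<alpha>" "\<alpha> \<le> 1 / 2"
  shows "0 < slope \<alpha> (rho_sharp \<alpha>) (Suc n)"
proof (induction n rule: less_induct)
  case (less n)
  have "rho_sharp \<alpha> j = -1" if "1 \<le> j" "j \<le> n" for j
    using less[of "j - 1"] that by (simp add: rho_sharp_pos not_le)
  then have eq: "slope \<alpha> (rho_sharp \<alpha>) (Suc n) = 1 - (\<Sum>j=1..n. \<alpha> ^ j)"
    using slope_minus_tail[of n "rho_sharp \<alpha>" 0 \<alpha>] by simp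
  have "0 < 1 - 2 * \<alpha> + \<alpha> ^ Suc n"
  proof (cases "0 < \<alpha>")
    case True
    then have "0 < \<alpha> ^ Suc n" by (rule zero_less_power)
    then show ?thesis using assms by linarith
  next
    case False
    \<comment> \<open>The last power is at most -\<alpha> in absolute value, so the whole expression
      is at least 1 - \<alpha>.\<close>
    have "\<bar>\<alpha>\<bar> ^ n \<le> 1"
      using False assms by (intro power_le_one) auto
    then have "\<bar>\<alpha> ^ Suc n\<bar> \<le> \<bar>\<alpha>\<bar>"
      using mult_left_le[of "\<bar>\<alpha>\<bar> ^ n" "\<bar>\<alpha>\<bar>"] by (simp add: abs_mult power_abs)
    then show ?thesis using False by linarith
  qed
  then have "0 < (1 - \<alpha>) * (1 - (\<Sum>j=1..n. \<alpha> ^ j))"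
    by (simp only: one_minus_geometric)
  then show ?case
    using assms unfolding eq by (simp add: zero_less_mult_iff)
qed

text \<open>With only minus signs after N, the sharp point would be exactly the midpoint of its
  interval of level N; this case has to be excluded for a strict separation.\<close>

lemma rho_sharp_plus_after_zero:
  assumes "1 \<le> N" "slope \<alpha> (rho_sharp \<alpha>) N = 0"
  shows "\<exists>j>N. rho_sharp \<alpha> j = 1"
proof (rule ccontr)
  assume no: "\<not> ?thesis"
  have minus: "rho_sharp \<alpha> j = -1" if "j > N" for j
    using no that sign_seqD[OF sign_seq_rho_sharp, of \<alpha> j] by auto
  have pos: "0 < slope \<alpha> (rho_sharp \<alpha>) j" if "j > N" for j
    using minus[OF that] that rho_sharp_pos[of j \<alpha>] by (auto split: if_splits)
  have one: "rho_sharp \<alpha> N = 1"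
    using assms by (simp add: rho_sharp_pos)
  have prod: "0 < \<alpha> ^ N * (1 - (\<Sum>j=1..i. \<alpha> ^ j))" for i
    using slope_minus_tail[of i "rho_sharp \<alpha>" N \<alpha>] minus assms(2) one pos[of "Suc (N + i)"] by simp
  \<comment> \<open>The case i = 0 shows that \<alpha>^N is positive, so it can be
    cancelled.\<close>
  from prod[of 0] have "0 < \<alpha> ^ N" by simp
  with prod have h: "0 < 1 - (\<Sum>j=1..i. \<alpha> ^ j)" for i
    using zero_less_mult_pos by blast
  \<comment> \<open>Each range fails for its own reason: in the first no slope of positive index
    vanishes; in the second the limit 1 - 2\<alpha> is negative; in the third i = 1 already fails;
    in the last the odd powers tend to minus infinity.\<close>
  consider "-1 \<le> \<alpha>" "\<alpha> \<le> 1 / 2" | "1 / 2 < \<alpha>" "\<alpha> < 1" | "1 \<le> \<alpha>" | "\<alpha> < -1"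
    by linarith
  then show False
  proof cases
    case 1
    with slope_rho_sharp_pos[of \<alpha> "N - 1"] assms show ?thesis by simp
  next
    case 2
    have "(\<lambda>i. 1 - 2 * \<alpha> + \<alpha> ^ Suc i) \<longlonglongrightarrow> 1 - 2 * \<alpha> + 0"
      using 2 by (intro tendsto_intros LIMSEQ_Suc LIMSEQ_power_zero) auto
    moreover have "0 \<le> 1 - 2 * \<alpha> + \<alpha> ^ Suc i" for i
      using h[of i] 2 by (simp only: one_minus_geometric[symmetric]) simp
    ultimately have "0 \<le> 1 - 2 * \<alpha> + 0"
      by (intro LIMSEQ_le_const) auto
    then show ?thesis using 2 by simp
  next
    case 3
    with h[of 1] show ?thesis by simp
  next
    case 4
    obtain k where "1 - 2 * \<alpha> < (-\<alpha>) ^ k"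
      using real_arch_pow[of "-\<alpha>"] 4 by auto
    also have "\<dots> \<le> (-\<alpha>) ^ Suc (2 * k)"
      using 4 by (intro power_increasing) auto
    also have "\<dots> = - (\<alpha> ^ Suc (2 * k))"
      by (rule power_minus_odd) simp
    finally have "(1 - \<alpha>) * (1 - (\<Sum>j=1..2 * k. \<alpha> ^ j)) < 0"
      by (simp only: one_minus_geometric)
    then show ?thesis
      using h[of "2 * k"] 4 by (simp add: mult_less_0_iff)
  qed
qed

text \<open>The two tie-breaking rules are mirror images of each other, so the equality of the
  slopes up to sign propagates also through later zeros.\<close>

lemma rho_flat_eq_minus_rho_sharp:
  assumes "1 \<le> N" "slope \<alpha> (rho_sharp \<alpha>) N = 0"
    and "\<And>k. 1 \<le> k \<Longrightarrow> k < N \<Longrightarrow> slope \<alpha> (rho_sharp \<alpha>) k \<noteq> 0" "N \<le> n"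
  shows "rho_flat \<alpha> n = - rho_sharp \<alpha> n"
proof -
  have "slope \<alpha> (rho_flat \<alpha>) N = slope \<alpha> (rho_sharp \<alpha>) N"
    by (intro slope_cong rho_flat_eq_rho_sharp[OF assms(3)]) auto
  \<comment> \<open>Both slopes vanish at N, so equality there is also equality up to sign, which
    starts the induction.\<close>
  then have zero: "slope \<alpha> (rho_flat \<alpha>) N = 0" by (simp add: assms(2))
  have "slope \<alpha> (rho_flat \<alpha>) n = - slope \<alpha> (rho_sharp \<alpha>) n"
    using \<open>N \<le> n\<close>
  proof (induction n rule: dec_induct)
    case (step n)
    then show ?case
      using assms(1) by (auto simp: slope_Suc rho_flat_pos rho_sharp_pos)
  qed (simp add: zero assms(2))
  then show ?thesis
    using assms by (simp add: rho_flat_pos rho_sharp_pos)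
qed

text \<open>\<open>c\<close> is the midpoint of the common interval of level N; at index N the sharp
  sequence turns left and the flat one right. A later sharp sign +1, which is a flat sign -1, keeps
  both points off \<open>c\<close>.\<close>

lemma tau_separation:
  assumes "1 \<le> N" "slope \<alpha> (rho_sharp \<alpha>) N = 0"
    and "\<And>k. 1 \<le> k \<Longrightarrow> k < N \<Longrightarrow> slope \<alpha> (rho_sharp \<alpha>) k \<noteq> 0"
  defines "c \<equiv> left_end (rho_sharp \<alpha>) N + 1 / 2 ^ Suc N"
  shows "tau_sharp \<alpha> < c" "c < tau_flat \<alpha>"
proof -
  obtain j where j: "j > N" "rho_sharp \<alpha> j = 1"
    using rho_sharp_plus_after_zero[OF assms(1,2)] by blast
  note flat = rho_flat_eq_minus_rho_sharp[OF assms(1-3)]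
  have "rho_sharp \<alpha> N = 1"
    using assms by (simp add: rho_sharp_pos)
  then have "left_end (rho_sharp \<alpha>) (Suc N) = left_end (rho_sharp \<alpha>) N"
    "left_end (rho_flat \<alpha>) (Suc N) = left_end (rho_flat \<alpha>) N + 1 / 2 ^ Suc N"
    using flat[of N] by (simp_all add: left_end_Suc)
  moreover have "left_end (rho_flat \<alpha>) N = left_end (rho_sharp \<alpha>) N"
    by (intro left_end_cong rho_flat_eq_rho_sharp[OF assms(3)]) auto
  ultimately show "tau_sharp \<alpha> < c" "c < tau_flat \<alpha>"
    using sign_point_less_right_end[OF sign_seq_rho_sharp, of "Suc N" j \<alpha>]
      left_end_less_sign_point[OF sign_seq_rho_flat, of "Suc N" j \<alpha>] j flat[of j]
    by (simp_all add: c_def tau_sharp_def tau_flat_def)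
qed

section \<open>Continuity and jumps of the two points\<close>

text \<open>With the signs frozen, each of the finitely many slopes involved is a polynomial in the
  parameter, nonzero at \<alpha>, and so keeps its sign nearby.\<close>

lemma eventually_rho_sharp_eq:
  assumes "\<And>k. 1 \<le> k \<Longrightarrow> k < N \<Longrightarrow> slope \<alpha> (rho_sharp \<alpha>) k \<noteq> 0"
  shows "\<forall>\<^sub>F \<beta> in nhds \<alpha>. \<forall>k<N. rho_sharp \<beta> k = rho_sharp \<alpha> k"
  using assms
proof (induction N)
  case (Suc N)
  have "((\<lambda>\<beta>. slope \<beta> (rho_sharp \<alpha>) N) \<longlongrightarrow> slope \<alpha> (rho_sharp \<alpha>) N) (nhds \<alpha>)"
    unfolding slope_def by (intro tendsto_intros filterlim_ident)
  \<comment> \<open>The implication is vacuous at N = 0, where the slope is zero and the sign is 1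
    by definition.\<close>
  then have ev: "\<forall>\<^sub>F \<beta> in nhds \<alpha>. slope \<alpha> (rho_sharp \<alpha>) N \<noteq> 0 \<longrightarrow>
      (slope \<beta> (rho_sharp \<alpha>) N \<le> 0 \<longleftrightarrow> slope \<alpha> (rho_sharp \<alpha>) N \<le> 0)"
    by (cases "slope \<alpha> (rho_sharp \<alpha>) N" "0::real" rule: linorder_cases)
       (auto dest: order_tendstoD(1)[of _ _ _ 0] order_tendstoD(2)[of _ _ _ 0] elim!: eventually_mono)
  from Suc have "\<forall>\<^sub>F \<beta> in nhds \<alpha>. \<forall>k<N. rho_sharp \<beta> k = rho_sharp \<alpha> k" by simp
  with ev show ?case
  proof eventually_elim
    case (elim \<beta>)
    then have "slope \<beta> (rho_sharp \<beta>) N = slope \<beta> (rho_sharp \<alpha>) N"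
      by (intro slope_cong) auto
    then have "rho_sharp \<beta> N = rho_sharp \<alpha> N"
      using elim Suc.prems[of N] by (cases "N = 0") (auto simp: rho_sharp_pos)
    with elim show ?case by (auto simp: less_Suc_eq)
  qed
qed simp

lemma eventually_rho_flat_eq:
  assumes "\<And>k. 1 \<le> k \<Longrightarrow> k < N \<Longrightarrow> slope \<alpha> (rho_flat \<alpha>) k \<noteq> 0"
  shows "\<forall>\<^sub>F \<beta> in nhds \<alpha>. \<forall>k<N. rho_flat \<beta> k = rho_flat \<alpha> k"
  using assms
proof (induction N)
  case (Suc N)
  have "((\<lambda>\<beta>. slope \<beta> (rho_flat \<alpha>) N) \<longlongrightarrow> slope \<alpha> (rho_flat \<alpha>) N) (nhds \<alpha>)"
    unfolding slope_def by (intro tendsto_intros filterlim_ident)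
  then have ev: "\<forall>\<^sub>F \<beta> in nhds \<alpha>. slope \<alpha> (rho_flat \<alpha>) N \<noteq> 0 \<longrightarrow>
      (slope \<beta> (rho_flat \<alpha>) N < 0 \<longleftrightarrow> slope \<alpha> (rho_flat \<alpha>) N < 0)"
    by (cases "slope \<alpha> (rho_flat \<alpha>) N" "0::real" rule: linorder_cases)
       (auto dest: order_tendstoD(1)[of _ _ _ 0] order_tendstoD(2)[of _ _ _ 0] elim!: eventually_mono)
  from Suc have "\<forall>\<^sub>F \<beta> in nhds \<alpha>. \<forall>k<N. rho_flat \<beta> k = rho_flat \<alpha> k" by simp
  with ev show ?case
  proof eventually_elim
    case (elim \<beta>)
    then have "slope \<beta> (rho_flat \<beta>) N = slope \<beta> (rho_flat \<alpha>) N"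
      by (intro slope_cong) auto
    then have "rho_flat \<beta> N = rho_flat \<alpha> N"
      using elim Suc.prems[of N] by (cases "N = 0") (auto simp: rho_flat_pos)
    with elim show ?case by (auto simp: less_Suc_eq)
  qed
qed simp

text \<open>Agreement of the first N signs puts both points into one dyadic interval of length
  1/2^N.\<close>

lemma isCont_sign_point:
  assumes "\<And>\<beta>. sign_seq (\<rho> \<beta>)" "\<And>N. \<forall>\<^sub>F \<beta> in nhds \<alpha>. \<forall>k<N. \<rho> \<beta> k = \<rho> \<alpha> k"
  shows "isCont (\<lambda>\<beta>. sign_point (\<rho> \<beta>)) \<alpha>"
proof -
  have "((\<lambda>\<beta>. sign_point (\<rho> \<beta>)) \<longlongrightarrow> sign_point (\<rho> \<alpha>)) (nhds \<alpha>)"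
  proof (rule tendstoI)
    fix e :: real assume "e > 0"
    obtain N where N: "(1 / 2) ^ N < e"
      using real_arch_pow_inv[of e "1 / 2"] \<open>e > 0\<close> by auto
    show "\<forall>\<^sub>F \<beta> in nhds \<alpha>. dist (sign_point (\<rho> \<beta>)) (sign_point (\<rho> \<alpha>)) < e"
      using assms(2)[of N]
    proof eventually_elim
      case (elim \<beta>)
      then have "left_end (\<rho> \<beta>) N = left_end (\<rho> \<alpha>) N"
        by (intro left_end_cong) auto
      then have "\<bar>sign_point (\<rho> \<beta>) - sign_point (\<rho> \<alpha>)\<bar> \<le> (1 / 2) ^ N"
        using sign_point_mem[OF assms(1), of \<beta> N] sign_point_mem[OF assms(1), of \<alpha> N]
        by (auto simp: dyadic_interval_def power_divide)
      with N show ?case by (simp add: dist_real_def)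
    qed
  qed
  then show ?thesis
    by (simp add: continuous_within tendsto_mono[OF at_within_le_nhds])
qed

lemma not_isCont_tau:
  assumes "1 \<le> N" "slope \<alpha> (rho_sharp \<alpha>) N = 0"
    and "\<And>k. 1 \<le> k \<Longrightarrow> k < N \<Longrightarrow> slope \<alpha> (rho_sharp \<alpha>) k \<noteq> 0"
  shows "\<not> (isCont tau_flat \<alpha> \<and> isCont tau_sharp \<alpha>)"
proof
  assume cont: "isCont tau_flat \<alpha> \<and> isCont tau_sharp \<alpha>"
  define c where "c = left_end (rho_sharp \<alpha>) N + 1 / 2 ^ Suc N"
  have sep: "tau_sharp \<alpha> < c" "c < tau_flat \<alpha>"
    unfolding c_def by (rule tau_separation[OF assms]; assumption)+
  have flat_eq: "rho_flat \<alpha> k = rho_sharp \<alpha> k" if "k < N" for k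
    using rho_flat_eq_rho_sharp[OF assms(3) that] .
  have "slope \<alpha> (rho_flat \<alpha>) k \<noteq> 0" if "1 \<le> k" "k < N" for k
    using slope_cong[of k "rho_flat \<alpha>" "rho_sharp \<alpha>" \<alpha>] flat_eq assms(3)[OF that] that by auto
  then have ev_flat: "\<forall>\<^sub>F \<beta> in at \<alpha>. \<forall>k<N. rho_flat \<beta> k = rho_sharp \<alpha> k"
    using eventually_rho_flat_eq[of N \<alpha>] flat_eq
    by (auto simp: eventually_at_filter elim: eventually_mono)
  have ev_sharp: "\<forall>\<^sub>F \<beta> in at \<alpha>. \<forall>k<N. rho_sharp \<beta> k = rho_sharp \<alpha> k"
    using eventually_rho_sharp_eq[of N \<alpha>] assms(3)
    by (auto simp: eventually_at_filter elim: eventually_mono)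
  have "finite {\<beta>. slope \<beta> (rho_sharp \<alpha>) N = 0}"
  proof -
    \<comment> \<open>The constant coefficient is \<open>rho_sharp \<alpha> 0 = 1\<close>, so this
      is a nonzero polynomial.\<close>
    have "finite {\<beta>::real. (\<Sum>i\<le>N - 1. rho_sharp \<alpha> i * \<beta> ^ i) = 0}"
      by (subst polyfun_finite_roots) (auto intro: exI[of _ 0])
    moreover have "{..<N} = {..N - 1}" using assms(1) by auto
    ultimately show ?thesis by (simp add: slope_def mult.commute)
  qed
  then have nz: "\<forall>\<^sub>F \<beta> in at \<alpha>. slope \<beta> (rho_sharp \<alpha>) N \<noteq> 0"
    using islimpt_finite[of "{\<beta>. slope \<beta> (rho_sharp \<alpha>) N = 0}" \<alpha>]
    by (simp add: islimpt_iff_eventually)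
  have "tau_sharp \<midarrow>\<alpha>\<rightarrow> tau_sharp \<alpha>" "tau_flat \<midarrow>\<alpha>\<rightarrow> tau_flat \<alpha>"
    using cont by (auto simp: isCont_def)
  \<comment> \<open>Continuity would carry the strict separation by \<open>c\<close> over to nearby
    parameters.\<close>
  then have "\<forall>\<^sub>F \<beta> in at \<alpha>. tau_sharp \<beta> < c" "\<forall>\<^sub>F \<beta> in at \<alpha>. c < tau_flat \<beta>"
    using sep by (blast intro: order_tendstoD)+
  then have "\<forall>\<^sub>F \<beta> in at \<alpha>. False"
    using ev_flat ev_sharp nz
  proof eventually_elim
    case (elim \<beta>)
    have "slope \<beta> (rho_flat \<beta>) N = slope \<beta> (rho_sharp \<alpha>) N"
      "slope \<beta> (rho_sharp \<beta>) N = slope \<beta> (rho_sharp \<alpha>) N"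
      using elim by (auto intro!: slope_cong)
    moreover have "left_end (rho_flat \<beta>) N = left_end (rho_sharp \<alpha>) N"
      "left_end (rho_sharp \<beta>) N = left_end (rho_sharp \<alpha>) N"
      using elim by (auto intro!: left_end_cong)
    moreover have "tau_flat \<beta> \<in> dyadic_interval (rho_flat \<beta>) (Suc N)"
      "tau_sharp \<beta> \<in> dyadic_interval (rho_sharp \<beta>) (Suc N)"
      unfolding tau_flat_def tau_sharp_def
      by (intro sign_point_mem sign_seq_rho_flat sign_seq_rho_sharp)+
    \<comment> \<open>A negative slope at \<beta> gives both sequences sign +1 at N, so both points
      are at most \<open>c\<close>; a positive one gives -1, so both are at least \<open>c\<close>.
      Either contradicts the separation.\<close>
    ultimately show False
      using elim assms(1)
      by (cases "slope \<beta> (rho_sharp \<alpha>) N < 0")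
         (auto simp: dyadic_interval_def left_end_Suc rho_flat_pos rho_sharp_pos c_def)
  qed
  then show False by simp
qed

section \<open>The four equivalent conditions\<close>

theorem proposition3p2:
  fixes \<alpha> :: real
  assumes "\<alpha> \<in> {-2<..<2}"
  defines "a \<equiv> \<exists>!t. t \<in> {0..1/2} \<and> is_maximizer \<alpha> t"
    and "b \<equiv> tau_flat \<alpha> = tau_sharp \<alpha>"
    and "c \<equiv> \<not> (\<exists>n\<ge>1. (\<Sum>m\<le>n. \<alpha> ^ m * rho_sharp \<alpha> m) = 0)"
    and "d \<equiv> continuous (at \<alpha> within {-2<..<2}) tau_flat
            \<and> continuous (at \<alpha> within {-2<..<2}) tau_sharp"
  shows "(a \<longleftrightarrow> b) \<and> (b \<longleftrightarrow> c) \<and> (c \<longleftrightarrow> d)"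
proof -
  have \<alpha>: "\<bar>\<alpha>\<bar> < 2" using assms(1) by auto
  have slope_eq: "(\<Sum>m\<le>n. \<alpha> ^ m * rho_sharp \<alpha> m) = slope \<alpha> (rho_sharp \<alpha>) (Suc n)" for n
    by (simp add: slope_def lessThan_Suc_atMost)
  \<comment> \<open>The sum up to n is the slope of index n + 1, so (c) concerns indices from 2 on;
    index 1 can be added because that slope is 1.\<close>
  have c_iff: "c \<longleftrightarrow> (\<forall>n\<ge>1. slope \<alpha> (rho_sharp \<alpha>) n \<noteq> 0)"
  proof
    assume c
    show "\<forall>n\<ge>1. slope \<alpha> (rho_sharp \<alpha>) n \<noteq> 0"
    proof (intro allI impI)
      fix n :: nat assume "n \<ge> 1"
      then consider "n = Suc 0" | k where "n = Suc k" "k \<ge> 1"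
        by (cases n) (auto simp: Suc_le_eq)
      then show "slope \<alpha> (rho_sharp \<alpha>) n \<noteq> 0"
        using \<open>c\<close> by cases (auto simp: slope_Suc[of _ _ 0] c_def slope_eq)
    qed
  qed (auto simp: c_def slope_eq)
  have d_iff: "d \<longleftrightarrow> isCont tau_flat \<alpha> \<and> isCont tau_sharp \<alpha>"
    unfolding d_def at_within_open[OF assms(1) open_greaterThanLessThan] ..
  have first_zero: "\<exists>N. 1 \<le> N \<and> slope \<alpha> (rho_sharp \<alpha>) N = 0 \<and>
      (\<forall>k. 1 \<le> k \<longrightarrow> k < N \<longrightarrow> slope \<alpha> (rho_sharp \<alpha>) k \<noteq> 0)" if "\<not> c"
    using that exists_least_iff[of "\<lambda>n. 1 \<le> n \<and> slope \<alpha> (rho_sharp \<alpha>) n = 0"]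
    unfolding c_iff by blast
  \<comment> \<open>Both sequences start with +1, so the interval of level 1 is the left
    half.\<close>
  have half: "dyadic_interval (rho_sharp \<alpha>) 1 = {0..1/2}" "dyadic_interval (rho_flat \<alpha>) 1 = {0..1/2}"
    by (simp_all add: dyadic_interval_def left_end_Suc)
  have max: "tau_flat \<alpha> \<in> {0..1/2} \<and> is_maximizer \<alpha> (tau_flat \<alpha>)"
    "tau_sharp \<alpha> \<in> {0..1/2} \<and> is_maximizer \<alpha> (tau_sharp \<alpha>)"
    unfolding tau_flat_def tau_sharp_def
    using sign_point_mem[OF sign_seq_rho_flat, of \<alpha> 1] sign_point_mem[OF sign_seq_rho_sharp, of \<alpha> 1]
      step_seq_maximizer[OF \<alpha> step_seq_rho_flat] step_seq_maximizer[OF \<alpha> step_seq_rho_sharp]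
    unfolding half by blast+
  \<comment> \<open>The scheme is a to b to c to a, together with both directions between c and
    d.\<close>
  have "a \<Longrightarrow> b"
    unfolding a_def b_def using max by blast
  moreover have "b \<Longrightarrow> c"
    using first_zero tau_separation[of _ \<alpha>] unfolding b_def by (metis less_asym)
  moreover have "a" if "c"
  proof -
    have "t = tau_sharp \<alpha>" if "t \<in> {0..1/2} \<and> is_maximizer \<alpha> t" for t
      unfolding tau_sharp_def
      using maximizer_unique[OF \<alpha> step_seq_rho_sharp] that \<open>c\<close> unfolding c_iff half by blast
    with max(2) show ?thesis unfolding a_def by blast
  qed
  moreover have "d" if "c"
  proof -
    have sharp: "slope \<alpha> (rho_sharp \<alpha>) n \<noteq> 0" if "1 \<le> n" for n
      using \<open>c\<close> that unfolding c_iff by blast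
    have "rho_flat \<alpha> n = rho_sharp \<alpha> n" for n
      by (rule rho_flat_eq_rho_sharp[of "Suc n"]) (use sharp in auto)
    then have "rho_flat \<alpha> = rho_sharp \<alpha>" by blast
    with sharp have flat: "slope \<alpha> (rho_flat \<alpha>) n \<noteq> 0" if "1 \<le> n" for n
      using that by simp
    show ?thesis
      unfolding d_iff tau_flat_def[abs_def] tau_sharp_def[abs_def]
      using sharp flat
      by (intro conjI isCont_sign_point sign_seq_rho_flat sign_seq_rho_sharp
          eventually_rho_flat_eq eventually_rho_sharp_eq) auto
  qed
  moreover have "c" if "d"
    using first_zero not_isCont_tau[of _ \<alpha>] that unfolding d_iff by metis
  ultimately show ?thesis by blast
qed

end
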